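(* Let $p,r\ge 1$ and $q\ge 2$ be integers, and let $\Gamma=\mathcal{C}_{p,q,r}$ where $p=q$ and $r$ is arbitrary (less than, equal to, or greater than $q$). Then $$\beta(\Gamma)=\begin{cases}2 & \text{if } q-r\neq 2,\\ 3 & \text{if } q-r=2.\end{cases}$$ (Equivalently, by interchanging the roles of $p$ and $r$: if $r=q$ and $p$ is arbitrary, then $\beta(\Gamma)=2$ if $q-p\ne 2$ and $\beta(\Gamma)=3$ if $q-p=2$.)
   Context: For a connected graph $\Gamma$ with vertex set $V(\Gamma)$, $d(u,v)$ is the length (number of edges) of a shortest path between $u$ and $v$. For an ordered set $R=\{w_1,\dots,w_t\}\subseteq V(\Gamma)$, the representation of a vertex $v$ with respect to $R$ is $(d(v,w_1),\dots,d(v,w_t))$. $R$ is a resolving set if distinct vertices have distinct representations with respect to $R$. The metric dimension $\beta(\Gamma)$ is the minimum cardinality of a resolving set of $\Gamma$. The graph $\mathcal{C}_{p,q,r}$ (base bicyclic graph of type III), for integers $p,r\ge 1$ and $q\ge 2$, is defined as follows. Take three disjoint paths $\mathcal{P}_1=v_1\cdots v_p$, $\mathcal{P}_2=v_{p+1}\cdots v_{p+q}$ and $\mathcal{P}_3=v_{p+q+1}\cdots v_{p+q+r}$ having $p$, $q$ and $r$ vertices respectively; join the starting vertices $v_1$ and $v_{p+q+1}$ of $\mathcal{P}_1$ and $\mathcal{P}_3$ to the starting vertex $v_{p+1}$ of $\mathcal{P}_2$, and join the ending vertices $v_p$ and $v_{p+q+r}$ of $\mathcal{P}_1$ and $\mathcal{P}_3$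 to the ending vertex $v_{p+q}$ of $\mathcal{P}_2$ (a one-vertex path has its starting vertex equal to its ending vertex). Thus $v_{p+1}$ and $v_{p+q}$ are joined by three internally disjoint paths of lengths $p+1$, $q-1$, $r+1$. Interchanging $p$ and $r$ gives an isomorphic graph: $\mathcal{C}_{p,q,r}\simeq\mathcal{C}_{r,q,p}$. *)

theory Defs
  imports "Graph_Theory.Graph_Theory"
begin

text \<open>
  A simple graph is a \<^locale>\<open>pair_graph\<close>: a finite loop-free digraph whose arc relation is
  symmetric, so that each undirected edge is the pair of its two opposite arcs.
\<close>

text \<open>Meaningful when some path joins the two vertices, e.g. in a connected graph.\<close>

definition graph_dist :: "('a, 'b) pre_digraph \<Rightarrow> 'a \<Rightarrow> 'a \<Rightarrow> nat" where
  "graph_dist G u v = (LEAST n. \<exists>es. pre_digraph.apath G u es v \<and> length es = n)"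

text \<open>Ordered sets of vertices are lists without repetitions; their cardinality is the length.\<close>

definition representation :: "('a, 'b) pre_digraph \<Rightarrow> 'a list \<Rightarrow> 'a \<Rightarrow> nat list" where
  "representation G ws v = map (graph_dist G v) ws"

definition resolving_set :: "('a, 'b) pre_digraph \<Rightarrow> 'a list \<Rightarrow> bool" where
  "resolving_set G ws \<longleftrightarrow>
     distinct ws \<and> set ws \<subseteq> verts G \<and> inj_on (representation G ws) (verts G)"

definition metric_dimension :: "('a, 'b) pre_digraph \<Rightarrow> nat" where
  "metric_dimension G = (LEAST n. \<exists>ws. resolving_set G ws \<and> length ws = n)"

text \<open>The arcs of the path on the \<open>n\<close> consecutive vertices \<open>a, \<dots>, a + n - 1\<close>, in one direction.\<close>

definition path_arcs :: "nat \<Rightarrow> nat \<Rightarrow> nat rel" where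
  "path_arcs a n = {(i, i + 1) | i. a \<le> i \<and> i + 1 < a + n}"

definition bicyclic_III_arcs :: "nat \<Rightarrow> nat \<Rightarrow> nat \<Rightarrow> nat rel" where
  "bicyclic_III_arcs p q r =
     path_arcs 1 p \<union> path_arcs (p + 1) q \<union> path_arcs (p + q + 1) r \<union>
     {(1, p + 1), (p + q + 1, p + 1), (p, p + q), (p + q + r, p + q)}"

definition bicyclic_III :: "nat \<Rightarrow> nat \<Rightarrow> nat \<Rightarrow> nat pair_pre_digraph" where
  "bicyclic_III p q r =
     \<lparr> pverts = {1..p + q + r},
       parcs = bicyclic_III_arcs p q r \<union> (bicyclic_III_arcs p q r)\<inverse> \<rparr>"

lemma pair_graph_bicyclic_III:
  assumes "1 \<le> p" "1 \<le> r" "2 \<le> q"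
  shows "pair_graph (bicyclic_III p q r)"
proof -
  let ?E = "parcs (bicyclic_III p q r)"
  have sub: "?E \<subseteq> {1..p + q + r} \<times> {1..p + q + r}"
    using assms by (auto simp: bicyclic_III_def bicyclic_III_arcs_def path_arcs_def)
  have fin: "finite ?E"
    using sub by (rule finite_subset) simp
  have loopfree: "fst e \<noteq> snd e" if "e \<in> ?E" for e
    using that assms by (auto simp: bicyclic_III_def bicyclic_III_arcs_def path_arcs_def)
  have "sym ?E"
    by (simp add: bicyclic_III_def sym_Un_converse)
  then have "symmetric (bicyclic_III p q r)"
    by (simp add: symmetric_def)
  then show ?thesis
    using sub fin loopfree by unfold_locales (auto simp: bicyclic_III_def)
qed

lemma connected_bicyclic_III:
  assumes "1 \<le> p" "1 \<le> r" "2 \<le> q"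
  shows "connected (bicyclic_III p q r)"
proof -
  let ?G = "bicyclic_III p q r"
  interpret pair_graph ?G using assms by (rule pair_graph_bicyclic_III)
  have arcI: "(u, v) \<in> parcs ?G"
    if "(u, v) \<in> bicyclic_III_arcs p q r \<or> (v, u) \<in> bicyclic_III_arcs p q r" for u v
    using that by (auto simp: bicyclic_III_def)
  have path: "a \<rightarrow>\<^sup>*\<^bsub>with_proj ?G\<^esub> (a + k)"
    if "path_arcs a n \<subseteq> bicyclic_III_arcs p q r" "a \<in> pverts ?G" "k < n" for a n k
    using that(3)
  proof (induction k)
    case 0
    then show ?case using that(2) by simp
  next
    case (Suc k)
    have "(a + k, a + Suc k) \<in> path_arcs a n"
      using Suc.prems by (auto simp: path_arcs_def)
    then have "(a + k, a + Suc k) \<in> parcs ?G"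
      using that(1) by (intro arcI) auto
    then show ?case using Suc.IH Suc.prems reachable_adj_trans by (meson Suc_lessD)
  qed
  have reach: "(p + 1) \<rightarrow>\<^sup>*\<^bsub>with_proj ?G\<^esub> v" if v: "v \<in> pverts ?G" for v
  proof -
    have r1: "1 \<rightarrow>\<^sup>*\<^bsub>with_proj ?G\<^esub> (1 + (v - 1))" if "v \<le> p"
      by (rule path[of 1 p]) (use that v assms in \<open>auto simp: bicyclic_III_arcs_def bicyclic_III_def\<close>)
    have r2: "(p + 1) \<rightarrow>\<^sup>*\<^bsub>with_proj ?G\<^esub> (p + 1 + (v - (p + 1)))" if "p < v" "v \<le> p + q"
      by (rule path[of "p + 1" q])
         (use that v assms in \<open>auto simp: bicyclic_III_arcs_def bicyclic_III_def\<close>)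
    have r3: "(p + q + 1) \<rightarrow>\<^sup>*\<^bsub>with_proj ?G\<^esub> (p + q + 1 + (v - (p + q + 1)))" if "p + q < v"
      by (rule path[of "p + q + 1" r])
         (use that v assms in \<open>auto simp: bicyclic_III_arcs_def bicyclic_III_def\<close>)
    have a1: "(p + 1, 1) \<in> parcs ?G"
      and a3: "(p + 1, p + q + 1) \<in> parcs ?G"
      by (rule arcI, simp add: bicyclic_III_arcs_def)+
    consider "v \<le> p" | "p < v" "v \<le> p + q" | "p + q < v" by linarith
    then show ?thesis
    proof cases
      case 1
      then have "1 + (v - 1) = v" using v by (simp add: bicyclic_III_def)
      then show ?thesis using adj_reachable_trans[OF a1 r1[OF 1]] by simp
    next
      case 2
      then have "p + 1 + (v - (p + 1)) = v" by simp
      then show ?thesis using r2[OF 2] by simp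
    next
      case 3
      then have "p + q + 1 + (v - (p + q + 1)) = v" by simp
      then show ?thesis using adj_reachable_trans[OF a3 r3[OF 3]] by simp
    qed
  qed
  have "u \<rightarrow>\<^sup>*\<^bsub>with_proj ?G\<^esub> v" if "u \<in> pverts ?G" "v \<in> pverts ?G" for u v
    using reach[OF that(1)] reach[OF that(2)] symmetric_reachable[OF sym_arcs]
    by (meson reachable_trans)
  moreover have "verts (with_proj ?G) \<noteq> {}" using assms by (auto simp: bicyclic_III_def)
  ultimately show ?thesis
    unfolding connected_def strongly_connected_def by (auto intro: reachable_mk_symmetricI)
qed

end

theory Submission
  imports Defs
begin

text \<open>
  The graph consists of three internally disjoint paths between two branch vertices, and the
  distance between two vertices is the least length among the direct way along a common path and
  the ways through a branch vertex. One landmark never resolves the graph, since the three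
  neighbours of a branch vertex cannot all be told apart from it and from each other.

  Let \<open>p = q\<close>. If \<open>r \<ge> q - 1\<close>, then the two end vertices of the first path resolve the graph.
  If \<open>r \<le> q - 3\<close>, then the starting vertex of the first path does so together with a vertex of that
  path that is almost antipodal, on the cycle formed by the first and third paths, to the branch
  vertex \<open>v\<^bsub>p+1\<^esub>\<close>. If \<open>r = q - 2\<close>, the second and third paths have equal length and the first is
  longer by two; every pair of landmarks then leaves some pair of vertices unseparated, which is
  exhibited explicitly according to the positions of the landmarks, while adding a vertex of the
  second path to the two end vertices of the first one makes a resolving set.
\<close>

section \<open>Distances\<close>

text \<open>At \<open>n = 0\<close> the relation power is the identity on the whole type, so
  membership of \<open>u\<close> in the graph is stated separately.\<close>

lemma (in wf_digraph) awalk_of_length_iff_relpow: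
  "(\<exists>es. awalk u es v \<and> length es = n) \<longleftrightarrow> u \<in> verts G \<and> (u, v) \<in> arcs_ends G ^^ n"
proof (induction n arbitrary: u)
  case 0
  then show ?case by (auto simp: awalk_Nil_iff)
next
  case (Suc n)
  have "(\<exists>es. awalk u es v \<and> length es = Suc n) \<longleftrightarrow>
      (\<exists>e es. awalk u (e # es) v \<and> length es = n)"
    by (metis length_Suc_conv)
  also have "\<dots> \<longleftrightarrow>
      (\<exists>e\<in>arcs G. u = tail G e \<and> (\<exists>es. awalk (head G e) es v \<and> length es = n))"
    by (simp only: awalk_Cons_iff) blast
  also have "\<dots> \<longleftrightarrow> (\<exists>e\<in>arcs G. u = tail G e \<and> (head G e, v) \<in> arcs_ends G ^^ n)"
    unfolding Suc.IH by auto
  also have "\<dots> \<longleftrightarrow> (u, v) \<in> arcs_ends G O arcs_ends G ^^ n"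
    by (auto simp: arcs_ends_conv relcomp_unfold)
  also have "\<dots> \<longleftrightarrow> u \<in> verts G \<and> (u, v) \<in> arcs_ends G ^^ Suc n"
    by (auto simp: relpow_commute[symmetric] arcs_ends_conv)
  finally show ?case .
qed

lemma (in wf_digraph) length_awalk_to_apath:
  assumes "awalk u es v"
  shows "length (awalk_to_apath es) \<le> length es"
  using assms
proof (induct rule: awalk_to_apath_induct)
  case (path es)
  then have "awalk_to_apath es = es"
    by (auto simp: awalk_to_apath.simps)
  then show ?case by simp
next
  case (decomp es a b c)
  have "es = a @ b @ c"
    using awalk_cyc_decomp_has_prop[OF decomp(1,3)] decomp(2) by simp
  then show ?case
    using step_awalk_to_apath[OF decomp(1,2,3)] decomp(4) by simp
qed

text \<open>Cutting the cycles out of a shortest walk gives a path that is no longer. If there is no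
  walk at all, both predicates are empty and their \<open>LEAST\<close> values coincide.\<close>

lemma (in wf_digraph) graph_dist_eq_relpow:
  assumes "u \<in> verts G"
  shows "graph_dist G u v = (LEAST n. (u, v) \<in> arcs_ends G ^^ n)"
proof -
  let ?P = "\<lambda>n. \<exists>es. apath u es v \<and> length es = n"
  let ?Q = "\<lambda>n. (u, v) \<in> arcs_ends G ^^ n"
  have PQ: "?Q n" if "?P n" for n
    using that awalk_of_length_iff_relpow[of u v n] awalkI_apath by blast
  have QP: "\<exists>m\<le>n. ?P m" if Qn: "?Q n" for n
  proof -
    obtain es where "awalk u es v" "length es = n"
      using Qn assms awalk_of_length_iff_relpow[of u v n] by blast
    then show ?thesis
      using length_awalk_to_apath apath_awalk_to_apath by blast
  qed
  show ?thesis
  proof (cases "\<exists>n. ?Q n")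
    case True
    then have Q: "?Q (Least ?Q)" by (rule LeastI_ex)
    then obtain m where m: "m \<le> Least ?Q" "?P m" using QP by blast
    then have "m = Least ?Q" using PQ Least_le[of ?Q m] by force
    then have "Least ?P = Least ?Q"
      using m PQ by (intro Least_equality) (auto intro: Least_le)
    then show ?thesis by (simp add: graph_dist_def)
  next
    case False
    then have "?P = ?Q" using PQ by blast
    then show ?thesis by (simp add: graph_dist_def)
  qed
qed

text \<open>The upper half of the distance computation: bounds on consecutive segments add up, and
  two bounds for one pair of vertices combine to their minimum.\<close>

definition within_dist :: "'a rel \<Rightarrow> nat \<Rightarrow> 'a \<Rightarrow> 'a \<Rightarrow> bool" where
  "within_dist E n u v \<longleftrightarrow> (\<exists>m\<le>n. (u, v) \<in> E ^^ m)"

lemma within_dist_refl: "within_dist E n u u"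
  unfolding within_dist_def by (intro exI[of _ 0]) simp

lemma within_dist_trans:
  assumes "within_dist E m u v" "within_dist E n v w"
  shows "within_dist E (m + n) u w"
proof -
  obtain a b where "a \<le> m" "b \<le> n" "(u, v) \<in> E ^^ a" "(v, w) \<in> E ^^ b"
    using assms by (auto simp: within_dist_def)
  then have "(u, w) \<in> E ^^ (a + b)" by (auto simp: relpow_add)
  then show ?thesis
    using \<open>a \<le> m\<close> \<open>b \<le> n\<close> unfolding within_dist_def by (meson add_le_mono)
qed

lemma sym_relpow: "sym E \<Longrightarrow> sym (E ^^ n)"
proof (induction n)
  case 0
  then show ?case by (simp add: sym_Id)
next
  case (Suc n)
  then have "(E ^^ n O E)\<inverse> = E O E ^^ n"
    by (simp add: converse_relcomp sym_conv_converse_eq)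
  then show ?case by (simp add: sym_conv_converse_eq relpow_commute)
qed

lemma within_dist_sym: "sym E \<Longrightarrow> within_dist E n u v \<Longrightarrow> within_dist E n v u"
  unfolding within_dist_def by (meson sym_relpow symD)

section \<open>Interchanging the outer paths\<close>

lemma relpow_hom:
  assumes "\<And>x y. (x, y) \<in> E \<Longrightarrow> (f x, f y) \<in> F" "(x, y) \<in> E ^^ n"
  shows "(f x, f y) \<in> F ^^ n"
  using assms(2)
proof (induction n arbitrary: y)
  case (Suc n)
  then show ?case using assms(1) by auto
qed simp

lemma resolving_set_map_isometry:
  assumes bij: "bij_betw f (verts G) (verts H)"
    and dist: "\<And>x y. x \<in> verts G \<Longrightarrow> y \<in> verts G \<Longrightarrow> graph_dist H (f x) (f y) = graph_dist G x y"
    and ws: "resolving_set G ws"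
  shows "resolving_set H (map f ws)"
proof -
  have sub: "set ws \<subseteq> verts G" and d: "distinct ws"
    and inj: "inj_on (representation G ws) (verts G)"
    using ws by (auto simp: resolving_set_def)
  have fi: "inj_on f (verts G)" and im: "f ` verts G = verts H"
    using bij by (auto simp: bij_betw_def)
  have rep: "representation H (map f ws) (f x) = representation G ws x" if "x \<in> verts G" for x
    using that sub dist by (auto simp: representation_def)
  have "inj_on (representation H (map f ws) \<circ> f) (verts G)"
    using inj rep by (simp add: inj_on_def)
  then have "inj_on (representation H (map f ws)) (verts H)"
    using inj_on_imageI im by metis
  moreover have "distinct (map f ws)"
    using d fi sub by (simp add: distinct_map inj_on_subset)
  moreover have "set (map f ws) \<subseteq> verts H" using sub im by auto
  ultimately show ?thesis by (simp add: resolving_set_def)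
qed

text \<open>Carries the first path onto the third and the third onto the first, keeping the
  direction of all three paths.\<close>

definition swap_outer :: "nat \<Rightarrow> nat \<Rightarrow> nat \<Rightarrow> nat \<Rightarrow> nat" where
  "swap_outer p q r x =
     (if x \<le> p then r + q + x else if x \<le> p + q then x - p + r else x - (p + q))"

lemma path_arcs_iff: "(x, y) \<in> path_arcs a n \<longleftrightarrow> y = x + 1 \<and> a \<le> x \<and> x + 1 < a + n"
  by (auto simp: path_arcs_def)

lemma swap_outer_arc:
  assumes "(x, y) \<in> parcs (bicyclic_III p q r)" "1 \<le> p" "2 \<le> q" "1 \<le> r"
  shows "(swap_outer p q r x, swap_outer p q r y) \<in> parcs (bicyclic_III r q p)"
proof -
  have *: "(swap_outer p q r x, swap_outer p q r y) \<in> bicyclic_III_arcs r q p"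
    if "(x, y) \<in> bicyclic_III_arcs p q r" for x y
  proof -
    have "y = x + 1 \<and> 1 \<le> x \<and> y \<le> p \<or> y = x + 1 \<and> p < x \<and> y \<le> p + q \<or>
        y = x + 1 \<and> p + q < x \<and> y \<le> p + q + r \<or> x = 1 \<and> y = p + 1 \<or>
        x = p + q + 1 \<and> y = p + 1 \<or> x = p \<and> y = p + q \<or> x = p + q + r \<and> y = p + q"
      using that unfolding bicyclic_III_arcs_def Un_iff path_arcs_iff insert_iff
      by (elim disjE conjE) simp_all
    then consider "y = x + 1" "1 \<le> x" "y \<le> p" | "y = x + 1" "p < x" "y \<le> p + q"
      | "y = x + 1" "p + q < x" "y \<le> p + q + r" | "x = 1" "y = p + 1" | "x = p + q + 1" "y = p + 1"
      | "x = p" "y = p + q" | "x = p + q + r" "y = p + q"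
      by blast
    then show ?thesis
    proof cases
      case 1
      then have "(r + q + x, r + q + y) \<in> path_arcs (r + q + 1) p" by (simp add: path_arcs_iff)
      then show ?thesis using 1 by (simp add: bicyclic_III_arcs_def swap_outer_def)
    next
      case 2
      then have "(x - p + r, y - p + r) \<in> path_arcs (r + 1) q" by (auto simp: path_arcs_iff)
      then show ?thesis using 2 by (simp add: bicyclic_III_arcs_def swap_outer_def)
    next
      case 3
      then have "(x - (p + q), y - (p + q)) \<in> path_arcs 1 r" by (auto simp: path_arcs_iff)
      then show ?thesis using 3 by (simp add: bicyclic_III_arcs_def swap_outer_def)
    qed (use assms in \<open>simp_all add: bicyclic_III_arcs_def swap_outer_def\<close>)
  qed
  show ?thesis using assms(1) * by (auto simp: bicyclic_III_def)
qed

lemma swap_outer_verts: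
  "x \<in> {1..p + q + r} \<Longrightarrow> swap_outer p q r x \<in> {1..r + q + p}"
  by (auto simp: swap_outer_def)

lemma swap_outer_swap_outer:
  "x \<in> {1..p + q + r} \<Longrightarrow> swap_outer r q p (swap_outer p q r x) = x"
  by (auto simp: swap_outer_def)

section \<open>Arithmetic of truncated differences\<close>

text \<open>One of the two truncated differences vanishes, so their sum is the absolute difference;
  two points equally far from \<open>a\<close> are equal or mirror images in
  \<open>a\<close>.\<close>

lemma diff_add_diff_eq:
  fixes a k l :: nat
  assumes "(k - a) + (a - k) = (l - a) + (a - l)"
  shows "k = l \<or> k + l = 2 * a"
  using assms by linarith

text \<open>In the lemmas named \<open>long\<close> or \<open>short\<close>, \<open>k\<close> and \<open>l\<close> are the positions of two
  vertices on their paths, and the equations say that they have the same distances to both landmarks.\<close>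

lemma long_outer_outer_aux:
  fixes k l m n :: nat
  assumes "1 \<le> m" "m + 1 \<le> n" "k \<le> m + 2" "n = l + l'"
    "(k - 1) + (1 - k) = min (l + 1) (m + 1 + l')"
    "(k - (m + 1)) + (m + 1 - k) = min (m + 1 + l) (l' + 1)"
  shows "k = 0 \<and> l = 0 \<or> k = m + 2 \<and> l' = 0"
proof -
  consider "k = 0" | "k = m + 2" | "1 \<le> k" "k \<le> m + 1" using assms(3) by linarith
  then show ?thesis
  proof cases
    case 1
    then show ?thesis using assms by simp
  next
    case 2
    then show ?thesis using assms by simp
  next
    case 3
    \<comment> \<open>Between the landmarks the two distances sum to \<open>m\<close>, whereas the
      two minima sum to at least \<open>m + 2\<close>.\<close>
    then have "k - 1 + (m + 1 - k) = m" by simp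
    then have "min (l + 1) (m + 1 + l') + min (m + 1 + l) (l' + 1) = m" using 3 assms by simp
    then show ?thesis using assms(2,4) by linarith
  qed
qed

lemma short_outer_same_aux:
  fixes k l n N j :: nat
  assumes "n + 3 \<le> N" "2 \<le> n" "2 * j \<le> N + n" "N + n \<le> 2 * j + 1" "N = k + k'" "N = l + l'" "k < l"
    "k + l = 2 * j" "min ((k - 1) + (1 - k)) (n + 1 + k') = min ((l - 1) + (1 - l)) (n + 1 + l')"
  shows False
proof (cases "k = 0")
  case True
  then have "min 1 (n + 1 + k') = min (l - 1) (n + 1 + l')" using assms by simp
  then show False using assms(1-8) True by linarith
next
  case False
  then have "min (k - 1) (n + 1 + k') = min (l - 1) (n + 1 + l')" using assms by simp
  \<comment> \<open>On a cycle of length \<open>N + n\<close>, two positions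
    \<open>1 \<le> k < l\<close> equally far from position 1 satisfy
    \<open>k + l = N + n + 2\<close>, which exceeds \<open>2 * j\<close>.\<close>
  then show False using assms(1-8) False by linarith
qed

lemma long_outer_middle_aux:
  fixes k l m :: nat
  assumes "k \<le> m + 2" "l \<le> m"
    "(k - 1) + (1 - k) = l + 1" "(k - (m + 1)) + (m + 1 - k) = m - l + 1"
  shows "k = 0 \<and> l = 0 \<or> k = m + 2 \<and> l = m"
proof -
  consider "k = 0" | "k = m + 2" | "1 \<le> k" "k \<le> m + 1" using assms(1) by linarith
  then show ?thesis
  proof cases
    case 3
    \<comment> \<open>The left sides sum to \<open>m\<close>, the right sides to
      \<open>m + 2\<close>.\<close>
    then have "k - 1 = l + 1" "m + 1 - k = m - l + 1" using assms(3,4) by simp_all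
    then show ?thesis using 3 assms(2) by simp
  qed (use assms in simp_all)
qed

lemma short_outer_middle_aux:
  fixes k l n :: nat
  assumes "n + 3 \<le> N" "2 \<le> n" "2 * j \<le> N + n" "N + n \<le> 2 * j + 1" "k \<le> N" "N = l + l' + 2"
    "k - j + (j - k) = min (j + l) ((N - j) + l')"
    "min ((k - 1) + (1 - k)) (n + 1 + (N - k)) = min (l + 1) (n + 1 + l')"
  shows "k = 0 \<and> l = 0 \<or> k = N \<and> l' = 0"
proof -
  have "j \<le> N" using assms(1,3) by linarith
  \<comment> \<open>The complements \<open>g\<close> and \<open>k'\<close> replace truncated
    differences, so that the rest is linear arithmetic.\<close>
  then obtain g k' where gk: "N = j + g" "N = k + k'" using assms(5) by (metis le_Suc_ex)
  then have N: "N - j = g" "N - k = k'" by simp_all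
  note a = assms(1-4,6) gk
  show ?thesis
  proof (cases "k = 0")
    case True
    then have "j = min (j + l) (g + l')" "1 = min (l + 1) (n + 1 + l')" using assms(2,7,8) N by simp_all
    then show ?thesis using a True by linarith
  next
    case False
    then have "min (k - 1) (n + 1 + k') = min (l + 1) (n + 1 + l')" using assms(8) N by simp
    then have "k = Suc (min (l + 1) (n + 1 + l')) \<and> k \<le> n + k' + 2 \<or>
        n + 1 + k' = min (l + 1) (n + 1 + l') \<and> n + k' + 2 \<le> k"
      using False by linarith
    moreover have "k - j + (j - k) = min (j + l) (g + l')" using assms(7) N by simp
    ultimately show ?thesis using a False
      by (elim disjE conjE) linarith+
  qed
qed

lemma short_outer_outer_aux:
  fixes k l n :: nat
  assumes "n + 3 \<le> N" "2 \<le> n" "2 * j \<le> N + n" "N + n \<le> 2 * j + 1" "k \<le> N" "n = l + l'"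
    "k - j + (j - k) = min (j + l) ((N - j) + l')"
    "min ((k - 1) + (1 - k)) (n + 1 + (N - k)) = l + 1"
  shows "k = 0 \<and> l = 0 \<or> k = N \<and> l' = 0"
proof -
  have "j \<le> N" using assms(1,3) by linarith
  then obtain g k' where gk: "N = j + g" "N = k + k'" using assms(5) by (metis le_Suc_ex)
  then have N: "N - j = g" "N - k = k'" by simp_all
  note a = assms(1-4,6) gk
  show ?thesis
  proof (cases "k = 0")
    case True
    then have "l = 0" using assms(2,7,8) N by simp
    then show ?thesis using a True by linarith
  next
    case False
    then have "min (k - 1) (n + 1 + k') = l + 1" using assms(8) N by simp
    then have "k = l + 2 \<and> k \<le> n + k' + 2 \<or> n + k' = l \<and> n + k' + 2 \<le> k"
      using False by linarith
    moreover have "k - j + (j - k) = min (j + l) (g + l')" using assms(7) N by simp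
    ultimately show ?thesis using a False by (elim disjE conjE) linarith+
  qed
qed

text \<open>Here \<open>b\<close> and \<open>d\<close> stand for detours over the opposite branch
  vertex; each is dominated by the direct way through that vertex and drops out.\<close>

lemma min_min_add:
  fixes a b c d x y :: nat
  assumes "c + y \<le> b + x" "a + x \<le> d + y"
  shows "min (min a b + x) (min c d + y) = min (a + x) (c + y)"
  using assms by linarith

section \<open>Coordinates\<close>

text \<open>The vertex \<open>vertex s k\<close> lies on the \<open>s\<close>-th of the three paths from \<open>v\<^bsub>p+1\<^esub>\<close> to \<open>v\<^bsub>p+q\<^esub>\<close>, at
  distance \<open>k\<close> along it, so the two branch vertices have three coordinates each.\<close>

locale bicyclic =
  fixes p q r :: nat
  assumes p: "1 \<le> p" and q: "2 \<le> q" and r: "1 \<le> r"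
begin

abbreviation G :: "nat pair_pre_digraph" where
  "G \<equiv> bicyclic_III p q r"

text \<open>Counts edges between the branch vertices: these are already the ends of the middle path,
  while each outer path gains one edge at either end.\<close>

definition len :: "nat \<Rightarrow> nat" where
  "len s = (if s = 0 then p + 1 else if s = 1 then q - 1 else r + 1)"

definition vertex :: "nat \<Rightarrow> nat \<Rightarrow> nat" where
  "vertex s k =
     (if k = 0 then p + 1 else if k = len s then p + q
      else if s = 0 then k else if s = 1 then p + 1 + k else p + q + k)"

lemma less_3_iff: "(s::nat) < 3 \<longleftrightarrow> s = 0 \<or> s = 1 \<or> s = 2"
  by auto

lemma len_pos: "0 < len s"
  using q by (simp add: len_def)

lemma vertex_0 [simp]: "vertex s 0 = p + 1"
  and vertex_len [simp]: "vertex s (len s) = p + q"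
  using len_pos[of s] by (auto simp: vertex_def)

lemma vertex_in_verts: "k \<le> len s \<Longrightarrow> vertex s k \<in> pverts G"
  using p q r by (auto simp: vertex_def len_def bicyclic_III_def split: if_splits)

lemma vertex_eq_iff:
  assumes "s < 3" "t < 3" "k \<le> len s" "l \<le> len t"
  shows "vertex s k = vertex t l \<longleftrightarrow>
    s = t \<and> k = l \<or> k = 0 \<and> l = 0 \<or> k = len s \<and> l = len t"
  using assms p q r unfolding less_3_iff
  by (elim disjE) (auto simp: vertex_def len_def split: if_splits)

lemma vertex_cases:
  assumes "x \<in> pverts G"
  obtains s k where "s < 3" "k \<le> len s" "x = vertex s k"
proof -
  have x: "1 \<le> x" "x \<le> p + q + r" using assms by (auto simp: bicyclic_III_def)
  consider "x \<le> p" | "p < x" "x \<le> p + q" | "p + q < x" by linarith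
  then show ?thesis
  proof cases
    case 1
    then show ?thesis using x by (intro that[of 0 x]) (auto simp: vertex_def len_def)
  next
    case 2
    then show ?thesis using q by (intro that[of 1 "x - (p + 1)"]) (auto simp: vertex_def len_def)
  next
    case 3
    then show ?thesis using x by (intro that[of 2 "x - (p + q)"]) (auto simp: vertex_def len_def)
  qed
qed

lemma vertex_arc:
  assumes "s < 3" "k < len s"
  shows "(vertex s k, vertex s (Suc k)) \<in> parcs G"
  using assms p q r unfolding less_3_iff
  by (elim disjE)
     (auto simp: vertex_def len_def bicyclic_III_def bicyclic_III_arcs_def path_arcs_def)

lemma arc_cases:
  assumes "(x, y) \<in> parcs G"
  obtains s k where "s < 3" "k < len s" "x = vertex s k" "y = vertex s (Suc k)"
  | s k where "s < 3" "k < len s" "y = vertex s k" "x = vertex s (Suc k)"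
proof -
  have *: "\<exists>s k. s < 3 \<and> k < len s \<and>
      (x = vertex s k \<and> y = vertex s (Suc k) \<or> y = vertex s k \<and> x = vertex s (Suc k))"
    (is "?P x y") if "(x, y) \<in> bicyclic_III_arcs p q r" for x y
  proof -
    have "?P x y" if "(x, y) \<in> path_arcs 1 p"
      using that by (intro exI[of _ 0] exI[of _ x]) (auto simp: path_arcs_def vertex_def len_def)
    moreover have "?P x y" if "(x, y) \<in> path_arcs (p + 1) q"
      using that by (intro exI[of _ 1] exI[of _ "x - (p + 1)"])
        (auto simp: path_arcs_def vertex_def len_def)
    moreover have "?P x y" if "(x, y) \<in> path_arcs (p + q + 1) r"
      using that by (intro exI[of _ 2] exI[of _ "x - (p + q)"])
        (auto simp: path_arcs_def vertex_def len_def)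
    moreover have "?P x y" if "x = 1" "y = p + 1"
      using that p by (intro exI[of _ 0] exI[of _ 0]) (auto simp: vertex_def len_def)
    moreover have "?P x y" if "x = p + q + 1" "y = p + 1"
      using that r by (intro exI[of _ 2] exI[of _ 0]) (auto simp: vertex_def len_def)
    moreover have "?P x y" if "x = p" "y = p + q"
      using that p by (intro exI[of _ 0] exI[of _ p]) (auto simp: vertex_def len_def)
    moreover have "?P x y" if "x = p + q + r" "y = p + q"
      using that r by (intro exI[of _ 2] exI[of _ r]) (auto simp: vertex_def len_def)
    ultimately show ?thesis
      using that unfolding bicyclic_III_arcs_def by blast
  qed
  have "(x, y) \<in> bicyclic_III_arcs p q r \<or> (y, x) \<in> bicyclic_III_arcs p q r"
    using assms by (auto simp: bicyclic_III_def)
  then show ?thesis using *[of x y] *[of y x] that by blast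
qed

text \<open>\<open>dist0\<close> and \<open>dist1\<close> are the distances to the branch vertices \<open>vertex s 0\<close> and
  \<open>vertex s (len s)\<close>.\<close>

definition minlen :: nat where
  "minlen = min (p + 1) (min (q - 1) (r + 1))"

definition dist0 :: "nat \<Rightarrow> nat \<Rightarrow> nat" where
  "dist0 s k = min k (minlen + (len s - k))"

definition dist1 :: "nat \<Rightarrow> nat \<Rightarrow> nat" where
  "dist1 s k = min (len s - k) (minlen + k)"

text \<open>Routes that leave through one branch vertex and arrive through the other are covered as
  well, since \<open>dist0\<close> and \<open>dist1\<close> already allow a crossing of length
  \<open>minlen\<close>.\<close>

definition cdist :: "nat \<Rightarrow> nat \<Rightarrow> nat \<Rightarrow> nat \<Rightarrow> nat" where
  "cdist s k t l =
     (let d = min (dist0 s k + dist0 t l) (dist1 s k + dist1 t l)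
      in if s = t then min d ((k - l) + (l - k)) else d)"

section \<open>The distance formula as a lower bound\<close>

lemma minlen_le: "minlen \<le> len s"
  by (auto simp: minlen_def len_def)

lemma minlen_cases: "\<exists>s<3. minlen = len s"
proof -
  have "minlen = len 0 \<or> minlen = len 1 \<or> minlen = len 2"
    by (auto simp: minlen_def len_def)
  then show ?thesis by (auto simp: less_3_iff)
qed

lemma dist_le_minlen_add:
  "k \<le> len s \<Longrightarrow> dist0 s k \<le> dist1 s k + minlen" "k \<le> len s \<Longrightarrow> dist1 s k \<le> dist0 s k + minlen"
  using minlen_le[of s] unfolding dist0_def dist1_def by linarith+

lemma dist_step:
  assumes "l < len t"
  shows "dist0 t (Suc l) \<le> Suc (dist0 t l)" "dist0 t l \<le> Suc (dist0 t (Suc l))"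
    "dist1 t (Suc l) \<le> Suc (dist1 t l)" "dist1 t l \<le> Suc (dist1 t (Suc l))"
  using assms unfolding dist0_def dist1_def by linarith+

text \<open>Every quantity in the minimum changes by at most one per edge; this drives the induction
  over walks.\<close>

lemma cdist_step:
  assumes "l < len t"
  shows "cdist s k t (Suc l) \<le> Suc (cdist s k t l)" "cdist s k t l \<le> Suc (cdist s k t (Suc l))"
  using dist_step[OF assms] unfolding cdist_def Let_def by (auto simp: min_le_iff_disj)

lemma cdist_0 [simp]: "k \<le> len s \<Longrightarrow> cdist s k t 0 = dist0 s k"
proof -
  assume "k \<le> len s"
  moreover have "dist0 s k \<le> k" by (simp add: dist0_def)
  moreover have "dist0 t 0 = 0" "dist1 t 0 = minlen"
    using minlen_le[of t] by (simp_all add: dist0_def dist1_def)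
  ultimately show ?thesis
    using dist_le_minlen_add[of k s] by (auto simp: cdist_def Let_def)
qed

lemma cdist_len [simp]: "k \<le> len s \<Longrightarrow> cdist s k t (len t) = dist1 s k"
proof -
  assume "k \<le> len s"
  moreover have "dist1 s k \<le> len s - k" by (simp add: dist1_def)
  moreover have "dist1 t (len t) = 0" "dist0 t (len t) = minlen"
    using minlen_le[of t] by (simp_all add: dist0_def dist1_def)
  ultimately show ?thesis
    using dist_le_minlen_add[of k s] by (auto simp: cdist_def Let_def)
qed

text \<open>Only branch vertices have several names, and there \<open>cdist_0\<close> and
  \<open>cdist_len\<close> give values independent of the path chosen.\<close>

lemma cdist_vertex_cong:
  assumes "s < 3" "t < 3" "t' < 3" "k \<le> len s" "l \<le> len t" "l' \<le> len t'" "vertex t l = vertex t' l'"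
  shows "cdist s k t l = cdist s k t' l'"
  using assms vertex_eq_iff[OF assms(2,3,5,6)] by auto

lemma cdist_le_of_relpow:
  assumes "s < 3" "k \<le> len s" "t < 3" "l \<le> len t" "(vertex s k, vertex t l) \<in> parcs G ^^ n"
  shows "cdist s k t l \<le> n"
  using assms(3-5)
proof (induction n arbitrary: t l)
  case 0
  \<comment> \<open>The coordinates may differ although the vertices coincide, namely at a branch
    vertex.\<close>
  then have "cdist s k t l = cdist s k s k"
    using cdist_vertex_cong[of s t s k l k] assms(1,2) by auto
  then show ?case by (simp add: cdist_def Let_def)
next
  case (Suc n)
  then obtain y where y: "(vertex s k, y) \<in> parcs G ^^ n" "(y, vertex t l) \<in> parcs G" by auto
  from y(2) show ?case
  proof (cases rule: arc_cases)
    case (1 t' l')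
    then have "cdist s k t' l' \<le> n" using Suc.IH[of t' l'] y by auto
    moreover have "cdist s k t l = cdist s k t' (Suc l')"
      using 1 Suc.prems assms(1,2) by (intro cdist_vertex_cong) auto
    ultimately show ?thesis using cdist_step[of l' t' s k] 1 by linarith
  next
    case (2 t' l')
    then have "cdist s k t' (Suc l') \<le> n" using Suc.IH[of t' "Suc l'"] y by auto
    moreover have "cdist s k t l = cdist s k t' l'"
      using 2 Suc.prems assms(1,2) by (intro cdist_vertex_cong) auto
    ultimately show ?thesis using cdist_step[of l' t' s k] 2 by linarith
  qed
qed

section \<open>Walks that attain the distance formula\<close>

lemma sym_parcs: "sym (parcs G)"
  by (simp add: bicyclic_III_def sym_Un_converse)

lemma within_along:
  assumes "s < 3" "k \<le> len s" "l \<le> len s"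
  shows "within_dist (parcs G) ((k - l) + (l - k)) (vertex s k) (vertex s l)"
proof -
  have *: "within_dist (parcs G) n (vertex s k) (vertex s (k + n))" if "k + n \<le> len s" for k n
    using that
  proof (induction n)
    case 0
    then show ?case by (simp add: within_dist_refl)
  next
    case (Suc n)
    have "within_dist (parcs G) 1 (vertex s (k + n)) (vertex s (k + Suc n))"
      using vertex_arc[OF assms(1), of "k + n"] Suc.prems
      unfolding within_dist_def by (intro exI[of _ 1]) auto
    then show ?case using within_dist_trans Suc by fastforce
  qed
  show ?thesis
  proof (cases "k \<le> l")
    case True
    then show ?thesis using *[of k "l - k"] assms by simp
  next
    case False
    then show ?thesis using *[of l "k - l"] assms within_dist_sym[OF sym_parcs] by simp
  qed
qed

lemma within_branch: "within_dist (parcs G) minlen (p + 1) (p + q)"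
  using minlen_cases within_along[of _ 0 "len s" for s] by (metis diff_0_eq_0 diff_zero
      le0 le_refl plus_nat.add_0 vertex_0 vertex_len)

lemma within_min: "within_dist E m u v \<Longrightarrow> within_dist E n u v \<Longrightarrow> within_dist E (min m n) u v"
  by (simp add: min_def)

lemma within_dist0:
  assumes "s < 3" "k \<le> len s"
  shows "within_dist (parcs G) (dist0 s k) (vertex s k) (p + 1)"
proof -
  have "within_dist (parcs G) k (vertex s k) (p + 1)"
    using within_along[of s k 0] assms by simp
  moreover have "within_dist (parcs G) (len s - k) (vertex s k) (p + q)"
    using within_along[of s k "len s"] assms by simp
  ultimately show ?thesis
    unfolding dist0_def using within_branch within_dist_sym[OF sym_parcs]
    by (metis within_min within_dist_trans add.commute)
qed

lemma within_dist1:
  assumes "s < 3" "k \<le> len s"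
  shows "within_dist (parcs G) (dist1 s k) (vertex s k) (p + q)"
proof -
  have "within_dist (parcs G) k (vertex s k) (p + 1)"
    using within_along[of s k 0] assms by simp
  moreover have "within_dist (parcs G) (len s - k) (vertex s k) (p + q)"
    using within_along[of s k "len s"] assms by simp
  ultimately show ?thesis
    unfolding dist1_def using within_branch
    by (metis within_min within_dist_trans add.commute)
qed

lemma within_cdist:
  assumes "s < 3" "k \<le> len s" "t < 3" "l \<le> len t"
  shows "within_dist (parcs G) (cdist s k t l) (vertex s k) (vertex t l)"
proof -
  have "within_dist (parcs G) (dist0 s k + dist0 t l) (vertex s k) (vertex t l)"
    and "within_dist (parcs G) (dist1 s k + dist1 t l) (vertex s k) (vertex t l)"
    using within_dist0 within_dist1 assms within_dist_trans within_dist_sym[OF sym_parcs] by meson+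
  then show ?thesis
    using within_along[of s k l] assms unfolding cdist_def Let_def
    by (auto intro!: within_min)
qed

lemma cdist_commute: "cdist s k t l = cdist t l s k"
  by (auto simp: cdist_def Let_def add.commute)

text \<open>A path closed up by a shortest connection of the branch vertices is a closed walk of
  length \<open>minlen + len s\<close>, and the distance is measured along it in the shorter
  direction.\<close>

lemma cdist_same:
  assumes "k \<le> len s" "l \<le> len s"
  shows "cdist s k s l = min ((k - l) + (l - k)) (minlen + len s - ((k - l) + (l - k)))"
proof -
  have *: "cdist s k s l = min (l - k) (minlen + len s - (l - k))"
    if kl: "k \<le> l" "l \<le> len s" for k l
  proof -
    obtain e f where ef: "l = k + e" "len s = k + e + f"
      using kl by (metis le_Suc_ex)
    define a b c d where "a = min k (minlen + (e + f))" and "b = min (k + e) (minlen + f)"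
      and "c = min (e + f) (minlen + k)" and "d = min f (minlen + (k + e))"
    have dist: "dist0 s k = a" "dist0 s l = b" "dist1 s k = c" "dist1 s l = d"
      by (simp_all add: dist0_def dist1_def ef a_def b_def c_def d_def)
    \<comment> \<open>The route through the first branch vertex is never better than both ways
      round, and at most as long as the outer way; the other route needs only the lower
      bound.\<close>
    have "min e (minlen + (k + f)) \<le> a + b" "a + b \<le> minlen + (k + f)"
      unfolding a_def b_def by linarith+
    moreover have "min e (minlen + (k + f)) \<le> c + d"
      unfolding c_def d_def by linarith
    ultimately have "min (min (a + b) (c + d)) e = min e (minlen + (k + f))" by linarith
    then show ?thesis unfolding cdist_def dist Let_def by (simp add: ef)
  qed
  show ?thesis using *[of k l] *[of l k] assms cdist_commute[of s k s l] by (cases "k \<le> l") auto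
qed

section \<open>Graph distance in coordinates\<close>

lemma pair_graph_G: "pair_graph G"
  using p q r by (intro pair_graph_bicyclic_III)

lemma graph_dist_relpow:
  "u \<in> pverts G \<Longrightarrow> graph_dist G u v = (LEAST n. (u, v) \<in> parcs G ^^ n)"
proof -
  interpret pair_graph G by (rule pair_graph_G)
  show "u \<in> pverts G \<Longrightarrow> graph_dist G u v = (LEAST n. (u, v) \<in> parcs G ^^ n)"
    using graph_dist_eq_relpow[of u v] by simp
qed

lemma graph_dist_vertex:
  assumes "s < 3" "k \<le> len s" "t < 3" "l \<le> len t"
  shows "graph_dist G (vertex s k) (vertex t l) = cdist s k t l"
proof -
  obtain m where m: "m \<le> cdist s k t l" "(vertex s k, vertex t l) \<in> parcs G ^^ m"
    using within_cdist[OF assms] by (auto simp: within_dist_def)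
  then have "m = cdist s k t l" using cdist_le_of_relpow[OF assms m(2)] by simp
  then show ?thesis
    using m cdist_le_of_relpow[OF assms] vertex_in_verts[OF assms(2)]
    by (subst graph_dist_relpow) (auto intro!: Least_equality)
qed

section \<open>Resolving sets\<close>

text \<open>Landmarks are given by coordinates. By symmetry it suffices to compare vertices with
  \<open>s \<le> t\<close>, which leaves six pairs of paths.\<close>

lemma resolving_setI:
  assumes "distinct (map (\<lambda>(a, i). vertex a i) cs)"
    and cs: "\<And>a i. (a, i) \<in> set cs \<Longrightarrow> a < 3 \<and> i \<le> len a"
    and step: "\<And>s k t l. s < 3 \<Longrightarrow> k \<le> len s \<Longrightarrow> t < 3 \<Longrightarrow> l \<le> len t \<Longrightarrow> s \<le> t \<Longrightarrow>
      (\<And>a i. (a, i) \<in> set cs \<Longrightarrow> cdist s k a i = cdist t l a i) \<Longrightarrow>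
      s = t \<and> k = l \<or> k = 0 \<and> l = 0 \<or> k = len s \<and> l = len t"
  shows "resolving_set G (map (\<lambda>(a, i). vertex a i) cs)"
proof -
  let ?ws = "map (\<lambda>(a, i). vertex a i) cs"
  have *: "vertex s k = vertex t l"
    if "s < 3" "k \<le> len s" "t < 3" "l \<le> len t"
      and eq: "\<And>a i. (a, i) \<in> set cs \<Longrightarrow> cdist s k a i = cdist t l a i"
    for s k t l
  proof (cases "s \<le> t")
    case True
    then show ?thesis using that step[of s k t l] vertex_eq_iff by presburger
  next
    case False
    then have "t = s \<and> l = k \<or> l = 0 \<and> k = 0 \<or> l = len t \<and> k = len s"
      using that by (intro step) auto
    then show ?thesis using that vertex_eq_iff by presburger
  qed
  have "x = y"
    if xy: "x \<in> pverts G" "y \<in> pverts G" and rep: "representation G ?ws x = representation G ?ws y"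
    for x y
  proof -
    obtain s k where x: "s < 3" "k \<le> len s" "x = vertex s k" using xy(1) by (rule vertex_cases)
    obtain t l where y: "t < 3" "l \<le> len t" "y = vertex t l" using xy(2) by (rule vertex_cases)
    have "cdist s k a i = cdist t l a i" if "(a, i) \<in> set cs" for a i
      using that rep x y cs[OF that] graph_dist_vertex by (auto simp: representation_def)
    then show ?thesis using *[OF x(1,2) y(1,2)] x y by simp
  qed
  moreover have "set ?ws \<subseteq> pverts G" using cs vertex_in_verts by auto
  ultimately show ?thesis using assms(1) by (auto simp: resolving_set_def inj_on_def)
qed

lemma resolving_set_neq:
  assumes "resolving_set G ws" "s < 3" "k \<le> len s" "t < 3" "l \<le> len t" "vertex s k \<noteq> vertex t l"
  shows "\<exists>w\<in>set ws. graph_dist G (vertex s k) w \<noteq> graph_dist G (vertex t l) w"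
proof (rule ccontr)
  assume "\<not> ?thesis"
  then have "representation G ws (vertex s k) = representation G ws (vertex t l)"
    by (simp add: representation_def)
  then show False
    using assms vertex_in_verts by (auto simp: resolving_set_def inj_on_def)
qed

text \<open>A neighbour's distance to a single landmark differs by at most one from that of the
  branch vertex. If all differ from it, three neighbours share two possible values.\<close>

lemma resolving_set_length_ge_2:
  assumes ws: "resolving_set G ws"
  shows "2 \<le> length ws"
proof (rule ccontr)
  assume "\<not> 2 \<le> length ws"
  then consider "ws = []" | w where "ws = [w]"
    by (cases ws; cases "tl ws") auto
  then show False
  proof cases
    case 1
    then show False
      using resolving_set_neq[OF ws, of 0 0 0 1] vertex_eq_iff[of 0 0 0 1] p by (auto simp: len_def)
  next
    case (2 w)
    then obtain t l where w: "t < 3" "l \<le> len t" "w = vertex t l"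
      using ws by (auto simp: resolving_set_def elim: vertex_cases)
    have neq: "cdist s k t l \<noteq> cdist s' k' t l"
      if "s < 3" "k \<le> len s" "s' < 3" "k' \<le> len s'" "vertex s k \<noteq> vertex s' k'" for s k s' k'
      using resolving_set_neq[OF ws that] 2 w that graph_dist_vertex by auto
    have l: "1 \<le> len s" for s using len_pos[of s] by simp
    \<comment> \<open>For \<open>q = 2\<close> the neighbour on the middle path is the other branch
      vertex; it is still distinct from the two outer neighbours.\<close>
    have l2: "1 < len 0" "1 < len 2" using p r by (simp_all add: len_def)
    have step: "cdist s 1 t l \<le> Suc (dist0 t l)" "dist0 t l \<le> Suc (cdist s 1 t l)" for s
      using cdist_step[of 0 s t l] l[of s] w cdist_commute[of s _ t l] by auto
    have n0: "cdist s 1 t l \<noteq> dist0 t l" if "s < 3" for s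
      using neq[of s 1 s 0] l[of s] that w vertex_eq_iff[of s s 1 0] cdist_commute[of s _ t l]
      by auto
    have "cdist 0 1 t l \<noteq> cdist 1 1 t l" "cdist 0 1 t l \<noteq> cdist 2 1 t l"
      "cdist 1 1 t l \<noteq> cdist 2 1 t l"
      using neq[of 0 1 1 1] neq[of 0 1 2 1] neq[of 1 1 2 1] l[of 1] l2
        vertex_eq_iff[of 0 1 1 1] vertex_eq_iff[of 0 2 1 1] vertex_eq_iff[of 1 2 1 1]
      by auto
    then show False using step[of 0] step[of 1] step[of 2] n0[of 0] n0[of 1] n0[of 2] by linarith
  qed
qed

lemma metric_dimension_eqI:
  assumes "resolving_set G ws" "length ws = n"
    and "\<And>ws. resolving_set G ws \<Longrightarrow> n \<le> length ws"
  shows "metric_dimension G = n"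
  unfolding metric_dimension_def using assms by (intro Least_equality) auto

section \<open>Two landmarks when the third path is longer than the second\<close>

lemma metric_dimension_long:
  assumes pq: "p = q" and rq: "q - 1 \<le> r"
  shows "metric_dimension G = 2"
proof -
  \<comment> \<open>These are the lengths of the second and third paths; the first has length
    \<open>m + 2\<close>, and its end vertices have positions \<open>1\<close> and
    \<open>m + 1\<close>.\<close>
  define m n where "m = q - 1" and "n = r + 1"
  have mn: "1 \<le> m" "m + 1 \<le> n" using q rq by (auto simp: m_def n_def)
  have L: "len 0 = m + 2" "len 1 = m" "len (Suc 0) = m" "len 2 = n" "minlen = m"
    unfolding len_def minlen_def m_def n_def using pq q rq by auto
  have e: "dist0 0 1 = 1" "dist1 0 1 = m + 1" "dist0 0 (m + 1) = m + 1" "dist1 0 (m + 1) = 1"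
    using mn by (simp_all add: dist0_def dist1_def L)
  have d0: "cdist 0 k 0 1 = (k - 1) + (1 - k)" "cdist 0 k 0 (m + 1) = (k - (m + 1)) + (m + 1 - k)"
    if "k \<le> m + 2" for k
  proof -
    show "cdist 0 k 0 1 = (k - 1) + (1 - k)"
      using that mn cdist_same[of k 0] unfolding L by simp
    show "cdist 0 k 0 (m + 1) = (k - (m + 1)) + (m + 1 - k)"
      using that mn cdist_same[of k 0] unfolding L by simp
  qed
  have d1: "cdist 1 k 0 1 = k + 1" "cdist 1 k 0 (m + 1) = m - k + 1" if "k \<le> m" for k
  proof -
    have "dist0 1 k = k" "dist1 1 k = m - k" using that by (simp_all add: dist0_def dist1_def L)
    then show "cdist 1 k 0 1 = k + 1" "cdist 1 k 0 (m + 1) = m - k + 1"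
      using that by (auto simp: cdist_def e[simplified] Let_def min_def)
  qed
  have d2: "cdist 2 k 0 1 = min (k + 1) (m + 1 + (n - k))"
    "cdist 2 k 0 (m + 1) = min (m + 1 + k) (n - k + 1)" for k
  proof -
    have "dist0 2 k + 1 = min (k + 1) (m + 1 + (n - k))"
      "dist1 2 k + (m + 1) = min (m + 1 + (n - k)) (m + m + 1 + k)"
      "dist0 2 k + (m + 1) = min (m + 1 + k) (m + m + 1 + (n - k))"
      "dist1 2 k + 1 = min (n - k + 1) (m + 1 + k)"
      by (simp_all add: dist0_def dist1_def L)
    then show "cdist 2 k 0 1 = min (k + 1) (m + 1 + (n - k))"
      "cdist 2 k 0 (m + 1) = min (m + 1 + k) (n - k + 1)"
      by (simp_all add: cdist_def e[simplified] Let_def min_def)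
  qed
  have "resolving_set G (map (\<lambda>(a, i). vertex a i) [(0, 1), (0, m + 1)])"
  proof (rule resolving_setI)
    show "distinct (map (\<lambda>(a, i). vertex a i) [(0, 1), (0, m + 1)])"
      using mn L vertex_eq_iff[of 0 0 1 "m + 1"] by simp
    show "a < 3 \<and> i \<le> len a" if "(a, i) \<in> set [(0, 1), (0, m + 1)]" for a i
      using that L mn by auto
    fix s k t l
    assume st: "s < 3" "k \<le> len s" "t < 3" "l \<le> len t" "s \<le> t"
      and "\<And>a i. (a, i) \<in> set [(0, 1), (0, m + 1)] \<Longrightarrow> cdist s k a i = cdist t l a i"
    then have eq: "cdist s k 0 1 = cdist t l 0 1" "cdist s k 0 (m + 1) = cdist t l 0 (m + 1)"
      by simp_all
    consider "s = 0" "t = 0" | "s = 0" "t = 1" | "s = 0" "t = 2" | "s = 1" "t = 1" | "s = 1" "t = 2"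
      | "s = 2" "t = 2"
      using st unfolding less_3_iff by linarith
    then show "s = t \<and> k = l \<or> k = 0 \<and> l = 0 \<or> k = len s \<and> l = len t"
    proof cases
      case 1
      \<comment> \<open>Distinct positions would have to satisfy both \<open>k + l = 2\<close> and
        \<open>k + l = 2 * m + 2\<close>.\<close>
      then show ?thesis using eq st d0[of k] d0[of l] mn
          diff_add_diff_eq[of k 1 l] diff_add_diff_eq[of k "m + 1" l]
        by (auto simp: L)
    next
      case 2
      then show ?thesis using eq st d0[of k] d1[of l] long_outer_middle_aux[of k m l] by (auto simp: L)
    next
      case 3
      then show ?thesis using eq st d0[of k] d2[of l] mn long_outer_outer_aux[of m n k l "n - l"]
        by (auto simp: L)
    next
      case 4
      then show ?thesis using eq st d1[of k] d1[of l] by (simp add: L)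
    next
      case 5
      define k' l' where "k' = m - k" and "l' = n - l"
      have kl: "m = k + k'" "n = l + l'"
        using 5 st(2,4) by (simp_all add: L k'_def l'_def)
      have "k + 1 = min (l + 1) (m + 1 + l')" "k' + 1 = min (m + 1 + l) (l' + 1)"
        using eq 5 st(2,4) d1[of k] d2[of l] by (simp_all add: L k'_def l'_def)
      \<comment> \<open>Away from the branch vertices this would give \<open>k = l\<close> and
        \<open>k' = l'\<close>, hence \<open>m = n\<close>.\<close>
      then have "k = 0 \<and> l = 0 \<or> k' = 0 \<and> l' = 0" using kl mn by linarith
      then show ?thesis using 5 kl by (auto simp: L)
    next
      case 6
      define k' l' where "k' = n - k" and "l' = n - l"
      have kl: "n = k + k'" "n = l + l'"
        using 6 st(2,4) by (simp_all add: L k'_def l'_def)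
      have "min (k + 1) (m + 1 + k') = min (l + 1) (m + 1 + l')"
        "min (m + 1 + k) (k' + 1) = min (m + 1 + l) (l' + 1)"
        using eq 6 d2[of k] d2[of l] by (simp_all add: L k'_def l'_def)
      then have "k = l" using kl mn by linarith
      then show ?thesis using 6 by simp
    qed
  qed
  then show ?thesis by (rule metric_dimension_eqI) (simp_all add: resolving_set_length_ge_2)
qed

section \<open>Two landmarks when the third path is shorter than the second\<close>

lemma metric_dimension_short:
  assumes pq: "p = q" and rq: "r + 3 \<le> q"
  shows "metric_dimension G = 2"
proof -
  \<comment> \<open>The first and third paths form a cycle of length \<open>N + n\<close>, and
    \<open>j\<close> is half of it rounded down. Thus no position on the first path has a shorter
    way to \<open>j\<close> than along that path.\<close>
  define N n j where "N = q + 1" and "n = r + 1" and "j = (q + r + 2) div 2"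
  have Nn: "n + 3 \<le> N" "2 \<le> n" using rq r by (auto simp: N_def n_def)
  have j: "2 * j \<le> N + n" "N + n \<le> 2 * j + 1" by (auto simp: N_def n_def j_def)
  have L: "len 0 = N" "len 1 = N - 2" "len (Suc 0) = N - 2" "len 2 = n" "minlen = n"
    unfolding len_def minlen_def N_def n_def using pq q rq by auto
  have e: "dist0 0 1 = 1" "dist1 0 1 = n + 1" "dist0 0 j = j" "dist1 0 j = N - j"
    using Nn j by (simp_all add: dist0_def dist1_def L)
  have d0: "cdist 0 k 0 1 = min ((k - 1) + (1 - k)) (n + 1 + (N - k))"
    "cdist 0 k 0 j = (k - j) + (j - k)" if "k \<le> N" for k
  proof -
    show "cdist 0 k 0 1 = min ((k - 1) + (1 - k)) (n + 1 + (N - k))"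
      using that Nn cdist_same[of k 0 1] by (cases k) (auto simp: L)
    show "cdist 0 k 0 j = (k - j) + (j - k)"
      using that Nn j cdist_same[of k 0 j] by (simp add: L)
  qed
  have d1: "cdist 1 k 0 1 = min (k + 1) (n + 1 + (N - 2 - k))"
    "cdist 1 k 0 j = min (j + k) ((N - j) + (N - 2 - k))" for k
  proof -
    have d: "dist0 1 k = min k (n + (N - 2 - k))" "dist1 1 k = min (N - 2 - k) (n + k)"
      by (simp_all add: dist0_def dist1_def L)
    have "cdist 1 k 0 1 = min (k + 1) (N - 2 - k + (n + 1))"
      unfolding cdist_def e d Let_def by (subst min_min_add) simp_all
    then show "cdist 1 k 0 1 = min (k + 1) (n + 1 + (N - 2 - k))" by (simp add: add.commute)
    have "cdist 1 k 0 j = min (k + j) (N - 2 - k + (N - j))"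
      unfolding cdist_def e d Let_def using j Nn by (subst min_min_add) simp_all
    then show "cdist 1 k 0 j = min (j + k) ((N - j) + (N - 2 - k))" by (simp add: add.commute)
  qed
  have d2: "cdist 2 k 0 1 = k + 1" "cdist 2 k 0 j = min (j + k) ((N - j) + (n - k))"
    if "k \<le> n" for k
  proof -
    have d: "dist0 2 k = k" "dist1 2 k = n - k" using that by (simp_all add: dist0_def dist1_def L)
    show "cdist 2 k 0 1 = k + 1" using that unfolding cdist_def e d Let_def by simp
    show "cdist 2 k 0 j = min (j + k) ((N - j) + (n - k))"
      unfolding cdist_def e d Let_def by (simp add: add.commute)
  qed
  have "resolving_set G (map (\<lambda>(a, i). vertex a i) [(0, 1), (0, j)])"
  proof (rule resolving_setI)
    show "distinct (map (\<lambda>(a, i). vertex a i) [(0, 1), (0, j)])"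
      using Nn j L vertex_eq_iff[of 0 0 1 j] by auto
    show "a < 3 \<and> i \<le> len a" if "(a, i) \<in> set [(0, 1), (0, j)]" for a i
      using that L Nn j by auto
    fix s k t l
    assume st: "s < 3" "k \<le> len s" "t < 3" "l \<le> len t" "s \<le> t"
      and "\<And>a i. (a, i) \<in> set [(0, 1), (0, j)] \<Longrightarrow> cdist s k a i = cdist t l a i"
    then have eq: "cdist s k 0 1 = cdist t l 0 1" "cdist s k 0 j = cdist t l 0 j"
      by simp_all
    consider "s = 0" "t = 0" | "s = 0" "t = 1" | "s = 0" "t = 2" | "s = 1" "t = 1" | "s = 1" "t = 2"
      | "s = 2" "t = 2"
      using st unfolding less_3_iff by linarith
    then show "s = t \<and> k = l \<or> k = 0 \<and> l = 0 \<or> k = len s \<and> l = len t"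
    proof cases
      case 1
      define k' l' where "k' = N - k" and "l' = N - l"
      have kl: "N = k + k'" "N = l + l'"
        using 1 st(2,4) by (simp_all add: L k'_def l'_def)
      have kN: "k \<le> N" "l \<le> N" using kl by simp_all
      have "min ((k - 1) + (1 - k)) (n + 1 + k') = min ((l - 1) + (1 - l)) (n + 1 + l')"
        unfolding k'_def l'_def using eq(1)[unfolded 1 d0(1)[OF kN(1)] d0(1)[OF kN(2)]] .
      moreover have "k = l \<or> k + l = 2 * j"
        using diff_add_diff_eq eq(2)[unfolded 1 d0(2)[OF kN(1)] d0(2)[OF kN(2)]] .
      ultimately have "k = l"
        using short_outer_same_aux[OF Nn j kl] short_outer_same_aux[OF Nn j kl(2,1)]
        by (metis add.commute linorder_neqE_nat)
      then show ?thesis using 1 by simp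
    next
      case 2
      then have kl: "k \<le> N" "N = l + (N - 2 - l) + 2" using st(2,4) Nn by (simp_all add: L)
      have "k = 0 \<and> l = 0 \<or> k = N \<and> N - 2 - l = 0"
        by (rule short_outer_middle_aux[OF Nn j kl])
          (use eq[unfolded 2 d0(1)[OF kl(1)] d0(2)[OF kl(1)] d1] in blast)+
      then show ?thesis using 2 kl by (auto simp: L)
    next
      case 3
      then have kl: "k \<le> N" "n = l + (n - l)" and ln: "l \<le> n" using st(2,4) by (simp_all add: L)
      have "k = 0 \<and> l = 0 \<or> k = N \<and> n - l = 0"
        by (rule short_outer_outer_aux[OF Nn j kl])
          (use eq[unfolded 3 d0(1)[OF kl(1)] d0(2)[OF kl(1)] d2(1)[OF ln] d2(2)[OF ln]] in blast)+
      then show ?thesis using 3 kl by (auto simp: L)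
    next
      case 4
      define k' l' where "k' = N - 2 - k" and "l' = N - 2 - l"
      have kl: "N = k + k' + 2" "N = l + l' + 2"
        using 4 st(2,4) Nn by (simp_all add: L k'_def l'_def)
      have "min (k + 1) (n + 1 + k') = min (l + 1) (n + 1 + l')"
        "min (j + k) ((N - j) + k') = min (j + l) ((N - j) + l')"
        using eq 4 d1[of k] d1[of l] by (simp_all add: L k'_def l'_def)
      \<comment> \<open>Otherwise \<open>k + l = N + n - 2\<close> and
        \<open>k + l + 2 * j = 2 * N - 2\<close>, so \<open>2 * j = N - n\<close>, which is too
        small.\<close>
      then have "k = l" using kl Nn j by linarith
      then show ?thesis using 4 by simp
    next
      case 5
      define k' l' where "k' = N - 2 - k" and "l' = n - l"
      have kl: "N = k + k' + 2" "n = l + l'"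
        using 5 st(2,4) Nn by (simp_all add: L k'_def l'_def)
      have "min (k + 1) (n + 1 + k') = l + 1"
        "min (j + k) ((N - j) + k') = min (j + l) ((N - j) + l')"
        using eq 5 st(2,4) d1[of k] d2[of l] by (simp_all add: L k'_def l'_def)
      then have "k = 0 \<and> l = 0 \<or> k' = 0 \<and> l' = 0" using kl Nn j by linarith
      then show ?thesis using 5 kl by (auto simp: L)
    next
      case 6
      then have "k \<le> n" "l \<le> n" using st(2,4) by (simp_all add: L)
      then have "k = l" using eq(1)[unfolded 6] d2(1)[of k] d2(1)[of l] by linarith
      then show ?thesis using 6 by simp
    qed
  qed
  then show ?thesis by (rule metric_dimension_eqI) (simp_all add: resolving_set_length_ge_2)
qed

subsection \<open>The exceptional case\<close>

definition unresolved :: "nat \<Rightarrow> nat \<Rightarrow> nat \<Rightarrow> nat \<Rightarrow> bool" where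
  "unresolved a i b j \<longleftrightarrow>
     (\<exists>s k t l. s < 3 \<and> k \<le> len s \<and> t < 3 \<and> l \<le> len t \<and> vertex s k \<noteq> vertex t l \<and>
        cdist s k a i = cdist t l a i \<and> cdist s k b j = cdist t l b j)"

text \<open>All witnesses used below lie on different paths, so they are distinct unless both name
  the same branch vertex.\<close>

lemma unresolvedI:
  assumes "s < 3" "t < 3" "k \<le> len s" "l \<le> len t" "s \<noteq> t" "k \<noteq> 0 \<or> l \<noteq> 0"
    "k \<noteq> len s \<or> l \<noteq> len t"
    and "cdist s k a i = cdist t l a i" "cdist s k b j = cdist t l b j"
  shows "unresolved a i b j"
  unfolding unresolved_def using assms vertex_eq_iff[of s t k l] by blast

lemma unresolved_commute: "unresolved a i b j \<Longrightarrow> unresolved b j a i"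
  unfolding unresolved_def by blast

end

locale bicyclic_exceptional = bicyclic +
  assumes pq: "p = q" and rq: "q = r + 2"
begin

definition m :: nat where "m = q - 1"

lemma m_ge: "2 \<le> m"
  unfolding m_def using rq r by simp

lemma len_exceptional: "len 0 = m + 2" "len 1 = m" "len (Suc 0) = m" "len 2 = m" "minlen = m"
  unfolding len_def minlen_def m_def using pq rq r by auto

text \<open>With lengths \<open>m + 2\<close>, \<open>m\<close>, \<open>m\<close>, a detour over the
  opposite branch vertex never beats the direct way through that vertex, so two plain sums
  remain.\<close>

lemma cdist_diff_exceptional:
  assumes "s < 3" "t < 3" "k \<le> len s" "l \<le> len t" "s \<noteq> t"
  shows "cdist s k t l = min (k + l) (len s - k + (len t - l))"
proof -
  have *: "cdist s k t l = min (k + l) (len s - k + (len t - l))"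
    if "len s = m" "k \<le> m" "len t = m + 2" "l \<le> m + 2" "s \<noteq> t" for s k t l
  proof -
    have "dist0 s k = k" "dist1 s k = m - k" using that by (auto simp: dist0_def dist1_def len_exceptional)
    moreover have "dist0 t l = min l (m + (m + 2 - l))" "dist1 t l = min (m + 2 - l) (m + l)"
      using that by (auto simp: dist0_def dist1_def len_exceptional)
    ultimately have "cdist s k t l = min (min l (m + (m + 2 - l)) + k) (min (m + 2 - l) (m + l) + (m - k))"
      using that by (simp add: cdist_def add.commute)
    also have "\<dots> = min (l + k) (m + 2 - l + (m - k))"
      using that by (subst min_min_add) simp_all
    finally show ?thesis using that by (simp add: add.commute)
  qed
  consider "s = 0" "t = 1 \<or> t = 2" | "s = 1 \<or> s = 2" "t = 0" | "s = 1 \<or> s = 2" "t = 1 \<or> t = 2"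
    using assms(1,2,5) by linarith
  then show ?thesis
  proof cases
    case 1
    then have "cdist t l s k = min (l + k) (len t - l + (len s - k))"
      using assms len_exceptional by (intro *) auto
    then show ?thesis using cdist_commute[of s k t l] by (simp add: add.commute)
  next
    case 2
    then show ?thesis using assms len_exceptional by (intro *) auto
  next
    case 3
    then have "len s = m" "len t = m" using len_exceptional by auto
    then show ?thesis using assms by (simp add: cdist_def dist0_def dist1_def len_exceptional(5))
  qed
qed

lemmas cdist_exceptional = cdist_same cdist_diff_exceptional

lemma inner_paths:
  assumes "{a, b} = {1, 2}"
  shows "len a = m" "len b = m" "a < 3" "b < 3" "0 < a" "0 < b" "a \<noteq> 0" "b \<noteq> 0" "a \<noteq> b" "b \<noteq> a"
  using assms len_exceptional by (auto simp: doubleton_eq_iff)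

text \<open>In the following lemmas \<open>a\<close> and \<open>b\<close> are the two paths of equal length \<open>m\<close>; path \<open>0\<close> has
  length \<open>m + 2\<close>.\<close>

lemma unresolved_outer_outer: "i \<le> m + 2 \<Longrightarrow> j \<le> m + 2 \<Longrightarrow> unresolved 0 i 0 j"
  \<comment> \<open>Exchanging the two paths of length \<open>m\<close> fixes path \<open>0\<close>;
    position 1 is an inner vertex since \<open>m \<ge> 2\<close>.\<close>
  using m_ge by (intro unresolvedI[of 1 2 1 1]) (simp_all add: cdist_exceptional len_exceptional)

text \<open>If neither landmark is the end of path \<open>a\<close>, both are reached through the
  start from its neighbours on the other two paths; dually at the end. Otherwise the landmarks are
  the two branch vertices, fixed by exchanging \<open>a\<close> and \<open>b\<close>.\<close>

lemma unresolved_same: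
  assumes ab: "{a, b} = {1, 2}" and ij: "i \<le> m" "j \<le> m"
  shows "unresolved a i a j"
proof -
  note s = cdist_exceptional len_exceptional(1,5) inner_paths[OF ab]
  consider "i < m" "j < m" | "0 < i" "0 < j" | "i = 0" "j = m" | "i = m" "j = 0"
    using ij m_ge by linarith
  then show ?thesis
  proof cases
    case 1
    then show ?thesis using m_ge by (intro unresolvedI[of 0 b 1 1]) (auto simp: s)
  next
    case 2
    then show ?thesis
      using m_ge ij by (intro unresolvedI[of 0 b "m + 1" "m - 1"]) (auto simp: s)
  next
    case 3
    then show ?thesis using m_ge by (intro unresolvedI[of a b 1 1]) (auto simp: s)
  next
    case 4
    then show ?thesis using m_ge by (intro unresolvedI[of a b 1 1]) (auto simp: s)
  qed
qed

text \<open>The witness on path \<open>0\<close> reaches both landmarks through one branch vertex.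
  The other lies on a landmark's path and reaches the second landmark through the opposite branch
  vertex. Equating the distances determines both positions.\<close>

lemma unresolved_inner_inner_aux:
  assumes ab: "{a, b} = {1, 2}" and ij: "i \<le> m" "j \<le> i"
  shows "unresolved a i b j"
proof -
  note s = cdist_exceptional len_exceptional(1,5) inner_paths[OF ab]
  consider "i = m" "j = 0" | "i < m" "i + j \<le> m" | "m < i + j"
    using ij by linarith
  then show ?thesis
  proof cases
    case 1
    then show ?thesis using m_ge by (intro unresolvedI[of a b 1 1]) (auto simp: s)
  next
    case 2
    \<comment> \<open>The common distances to the landmarks are \<open>m - j\<close> and
      \<open>m - i\<close>.\<close>
    then show ?thesis
      using m_ge ij by (intro unresolvedI[of b 0 "m + j - i" "m - i - j"]) (auto simp: s)
  next
    case 3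
    \<comment> \<open>The common distances to the landmarks are \<open>j\<close> and
      \<open>i\<close>.\<close>
    then show ?thesis
      using m_ge ij by (intro unresolvedI[of a 0 "i - j" "2 * m + 2 - i - j"]) (auto simp: s)
  qed
qed

lemma unresolved_inner_inner:
  assumes "{a, b} = {1, 2}" "i \<le> m" "j \<le> m"
  shows "unresolved a i b j"
  using unresolved_inner_inner_aux[of a b i j] unresolved_inner_inner_aux[of b a j i]
    unresolved_commute assms by (metis insert_commute nat_le_linear)

text \<open>If \<open>i\<close> is \<open>0\<close> or \<open>m\<close>, exchanging \<open>a\<close>
  and \<open>b\<close> fixes both landmarks. Reversing all paths sends \<open>i\<close> to
  \<open>m - i\<close> and \<open>j\<close> to \<open>m + 2 - j\<close>, which pairs cases 2 and 3,
  4 and 5, 6 and 7.\<close>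

lemma unresolved_inner_outer:
  assumes ab: "{a, b} = {1, 2}" and ij: "i \<le> m" "j \<le> m + 2"
  shows "unresolved a i 0 j"
proof -
  note s = cdist_exceptional len_exceptional(1,5) inner_paths[OF ab]
  have "i < j \<and> i + j \<le> m + 1 \<or> j \<le> i + 1 \<and> m + 1 \<le> i + j \<or> j \<le> i \<and> i + j \<le> m \<or>
      i + 2 \<le> j \<and> m + 2 \<le> i + j"
    by linarith
  moreover have "i = 0 \<or> i = m \<or> 0 < i \<and> i < m" "j = 0 \<or> j = m + 2 \<or> 0 < j \<and> j < m + 2"
    using ij by linarith+
  ultimately consider "i = 0 \<or> i = m" | "0 < i" "i < m" "j = 0" | "0 < i" "i < m" "j = m + 2"
    | "0 < i" "i < m" "0 < j" "i < j" "i + j \<le> m + 1"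
    | "0 < i" "i < m" "j < m + 2" "j \<le> i + 1" "m + 1 \<le> i + j"
    | "0 < i" "i < m" "0 < j" "j \<le> i" "i + j \<le> m"
    | "0 < i" "i < m" "j < m + 2" "i + 2 \<le> j" "m + 2 \<le> i + j"
    by blast
  then show ?thesis
  proof cases
    case 1
    then show ?thesis using m_ge ij by (intro unresolvedI[of a b 1 1]) (auto simp: s)
  next
    case 2
    then show ?thesis using m_ge by (intro unresolvedI[of 0 b 1 1]) (auto simp: s)
  next
    case 3
    then show ?thesis
      using m_ge ij by (intro unresolvedI[of 0 b "m + 1" "m - 1"]) (auto simp: s)
  next
    case 4
    \<comment> \<open>The witness on \<open>b\<close> reaches both landmarks through the start, at
      distances \<open>m + 1 - j\<close> and \<open>m + 1 - i\<close>; the one on \<open>a\<close>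
      reaches path \<open>0\<close> through the end.\<close>
    then show ?thesis
      using m_ge ij by (intro unresolvedI[of a b "m + 1 + i - j" "m + 1 - i - j"]) (auto simp: s)
  next
    case 5
    then show ?thesis
      using m_ge ij by (intro unresolvedI[of a b "i + 1 - j" "2 * m + 1 - i - j"]) (auto simp: s)
  next
    case 6
    \<comment> \<open>The same vertex of \<open>b\<close> and the same distances as in case 4; its
      partner now lies on path \<open>0\<close>, beyond the landmark.\<close>
    then show ?thesis
      using m_ge ij by (intro unresolvedI[of b 0 "m + 1 - i - j" "m + 1 + j - i"]) (auto simp: s)
  next
    case 7
    then show ?thesis
      using m_ge ij by (intro unresolvedI[of b 0 "2 * m + 1 - i - j" "j - i - 1"]) (auto simp: s)
  qed
qed

lemma unresolved_all:
  assumes "a < 3" "b < 3" "i \<le> len a" "j \<le> len b"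
  shows "unresolved a i b j"
proof -
  have "a = 0 \<and> b = 0 \<or> a \<in> {1, 2} \<and> b = a \<or> {a, b} = {1, 2} \<or>
      a \<in> {1, 2} \<and> b = 0 \<or> a = 0 \<and> b \<in> {1, 2}"
    using assms(1,2) unfolding less_3_iff by auto
  then show ?thesis
    using assms(3,4) unresolved_outer_outer[of i j] unresolved_same[of 1 2 i j]
      unresolved_same[of 2 1 i j] unresolved_inner_inner[of a b i j]
      unresolved_inner_outer[of 1 2 i j] unresolved_inner_outer[of 2 1 i j]
      unresolved_inner_outer[of 1 2 j i] unresolved_inner_outer[of 2 1 j i]
      unresolved_commute[of b j a i]
    by (auto simp: len_exceptional insert_commute doubleton_eq_iff)
qed

lemma resolving_set_length_ge_3:
  assumes ws: "resolving_set G ws"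
  shows "3 \<le> length ws"
proof (rule ccontr)
  assume "\<not> 3 \<le> length ws"
  then have "length ws = Suc (Suc 0)" using resolving_set_length_ge_2[OF ws] by simp
  then obtain v w where vw: "ws = [v, w]" by (auto simp: length_Suc_conv)
  then have verts: "v \<in> pverts G" "w \<in> pverts G" using ws by (auto simp: resolving_set_def)
  obtain a i where v: "a < 3" "i \<le> len a" "v = vertex a i" using verts(1) by (rule vertex_cases)
  obtain b j where w: "b < 3" "j \<le> len b" "w = vertex b j" using verts(2) by (rule vertex_cases)
  obtain s k t l where st: "s < 3" "k \<le> len s" "t < 3" "l \<le> len t" "vertex s k \<noteq> vertex t l"
    and eq: "cdist s k a i = cdist t l a i" "cdist s k b j = cdist t l b j"
    using unresolved_all[OF v(1) w(1) v(2) w(2)] unfolding unresolved_def by blast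
  show False
    using resolving_set_neq[OF ws st] st eq v w vw graph_dist_vertex by auto
qed

section \<open>Three landmarks in the exceptional case\<close>

lemma metric_dimension_exceptional: "metric_dimension G = 3"
proof -
  \<comment> \<open>The ends of path \<open>0\<close> confuse only equal positions on paths 1 and 2;
    the third landmark breaks the symmetry between these paths.\<close>
  let ?cs = "[(0, 1), (0, m + 1), (1, 1)]"
  note L = len_exceptional
  have "resolving_set G (map (\<lambda>(a, i). vertex a i) ?cs)"
  proof (rule resolving_setI)
    show "distinct (map (\<lambda>(a, i). vertex a i) ?cs)"
      using m_ge L vertex_eq_iff[of 0 0 1 "m + 1"] vertex_eq_iff[of 0 1 1 1]
        vertex_eq_iff[of 0 1 "m + 1" 1] by simp
    show "a < 3 \<and> i \<le> len a" if "(a, i) \<in> set ?cs" for a i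
      using that L m_ge by auto
    fix s k t l
    assume st: "s < 3" "k \<le> len s" "t < 3" "l \<le> len t" "s \<le> t"
      and "\<And>a i. (a, i) \<in> set ?cs \<Longrightarrow> cdist s k a i = cdist t l a i"
    then have eq: "cdist s k 0 1 = cdist t l 0 1" "cdist s k 0 (m + 1) = cdist t l 0 (m + 1)"
      "cdist s k 1 1 = cdist t l 1 1"
      by simp_all
    have d0: "cdist 0 k 0 1 = (k - 1) + (1 - k)" "cdist 0 k 0 (m + 1) = (k - (m + 1)) + (m + 1 - k)"
      if "k \<le> m + 2" for k
    proof -
      show "cdist 0 k 0 1 = (k - 1) + (1 - k)"
        using that m_ge cdist_same[of k 0 1] by (simp add: L)
      show "cdist 0 k 0 (m + 1) = (k - (m + 1)) + (m + 1 - k)"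
        using that m_ge cdist_same[of k 0 "m + 1"] by (simp add: L)
    qed
    have d1: "cdist 1 k 0 1 = k + 1" "cdist 1 k 0 (m + 1) = m - k + 1"
      "cdist 1 k 1 1 = (k - 1) + (1 - k)" if "k \<le> m" for k
    proof -
      show "cdist 1 k 0 1 = k + 1" "cdist 1 k 0 (m + 1) = m - k + 1"
        using that cdist_diff_exceptional[of 1 0 k 1] cdist_diff_exceptional[of 1 0 k "m + 1"]
        by (simp_all add: L)
      show "cdist 1 k 1 1 = (k - 1) + (1 - k)"
        using that m_ge cdist_same[of k 1 1] by (simp add: L)
    qed
    have d2: "cdist 2 k 0 1 = k + 1" "cdist 2 k 0 (m + 1) = m - k + 1"
      "cdist 2 k 1 1 = min (k + 1) (m - 1 + (m - k))" if "k \<le> m" for k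
    proof -
      show "cdist 2 k 0 1 = k + 1" "cdist 2 k 0 (m + 1) = m - k + 1"
        using that cdist_diff_exceptional[of 2 0 k 1] cdist_diff_exceptional[of 2 0 k "m + 1"]
        by (simp_all add: L)
      show "cdist 2 k 1 1 = min (k + 1) (m - 1 + (m - k))"
        using that m_ge cdist_diff_exceptional[of 2 1 k 1] by (simp add: L add.commute)
    qed
    consider "s = 0" "t = 0" | "s = 0" "t = 1" | "s = 0" "t = 2" | "s = 1" "t = 1" | "s = 1" "t = 2"
      | "s = 2" "t = 2"
      using st unfolding less_3_iff by linarith
    then show "s = t \<and> k = l \<or> k = 0 \<and> l = 0 \<or> k = len s \<and> l = len t"
    proof cases
      case 1
      then show ?thesis using eq st d0[of k] d0[of l] m_ge
          diff_add_diff_eq[of k 1 l] diff_add_diff_eq[of k "m + 1" l]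
        by (auto simp: L)
    next
      case 2
      then show ?thesis using eq st d0[of k] d1[of l] long_outer_middle_aux[of k m l] by (auto simp: L)
    next
      case 3
      then show ?thesis using eq st d0[of k] d2[of l] long_outer_middle_aux[of k m l] by (auto simp: L)
    next
      case 4
      then show ?thesis using eq st d1[of k] d1[of l] by (simp add: L)
    next
      case 5
      then have kl: "k \<le> m" "l \<le> m" using st(2,4) by (simp_all add: L)
      have "k = l" using eq(1)[unfolded 5 d1(1)[OF kl(1)] d2(1)[OF kl(2)]] by simp
      moreover have "(k - 1) + (1 - k) = min (l + 1) (m - 1 + (m - l))"
        using eq(3)[unfolded 5 d1(3)[OF kl(1)] d2(3)[OF kl(2)]] .
      \<comment> \<open>An inner vertex of path 1 is strictly closer to position 1 of that path than
        its twin on path 2.\<close>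
      ultimately have "k = 0 \<and> l = 0 \<or> k = m \<and> l = m" using m_ge kl by (cases l) auto
      then show ?thesis using 5 by (auto simp: L)
    next
      case 6
      then have "k \<le> m" "l \<le> m" using st(2,4) by (simp_all add: L)
      then have "k = l" using eq(1)[unfolded 6] d2(1)[of k] d2(1)[of l] by linarith
      then show ?thesis using 6 by simp
    qed
  qed
  then show ?thesis by (rule metric_dimension_eqI) (simp_all add: resolving_set_length_ge_3)
qed

end

section \<open>Interchange symmetry and conclusion\<close>

lemma metric_dimension_bicyclic_III_commute:
  assumes "1 \<le> p" "1 \<le> r" "2 \<le> q"
  shows "metric_dimension (bicyclic_III p q r) = metric_dimension (bicyclic_III r q p)"
proof -
  \<comment> \<open>Stated for arbitrary parameters so that it applies in both directions.\<close>
  have ex: "\<exists>ws'. resolving_set (bicyclic_III r q p) ws' \<and> length ws' = length ws"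
    if "1 \<le> p" "1 \<le> r" "2 \<le> q" "resolving_set (bicyclic_III p q r) ws" for p q r ws
  proof -
    interpret G: bicyclic p q r using that by unfold_locales
    interpret H: bicyclic r q p using that by unfold_locales
    let ?f = "swap_outer p q r" and ?g = "swap_outer r q p"
    have vG: "pverts G.G = {1..p + q + r}" and vH: "pverts H.G = {1..r + q + p}"
      by (simp_all add: bicyclic_III_def)
    have bij: "bij_betw ?f (pverts G.G) (pverts H.G)"
      unfolding vG vH
      by (rule bij_betw_byWitness[where f' = ?g])
        (use swap_outer_verts swap_outer_swap_outer in blast)+
    have hom: "(?f x, ?f y) \<in> parcs H.G ^^ n" if "(x, y) \<in> parcs G.G ^^ n" for x y n
      by (rule relpow_hom[OF _ that]) (use swap_outer_arc G.p G.q G.r in blast)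
    have hom': "(x, y) \<in> parcs G.G ^^ n"
      if "(?f x, ?f y) \<in> parcs H.G ^^ n" "x \<in> pverts G.G" "y \<in> pverts G.G" for x y n
    proof -
      have "(?g (?f x), ?g (?f y)) \<in> parcs G.G ^^ n"
        by (rule relpow_hom[OF _ that(1)]) (use swap_outer_arc G.p G.q G.r in blast)
      then show ?thesis using that(2,3) swap_outer_swap_outer by (simp add: vG)
    qed
    have dist: "graph_dist H.G (?f x) (?f y) = graph_dist G.G x y"
      if "x \<in> pverts G.G" "y \<in> pverts G.G" for x y
    proof -
      have "?f x \<in> pverts H.G" using bij that(1) by (auto simp: bij_betw_def)
      then show ?thesis
        using hom hom' that by (simp add: G.graph_dist_relpow H.graph_dist_relpow) metis
    qed
    have "resolving_set H.G (map ?f ws)"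
      using bij dist that(4) by (intro resolving_set_map_isometry[of ?f G.G]) simp_all
    then show ?thesis by (intro exI[of _ "map ?f ws"]) simp
  qed
  have "(\<exists>ws. resolving_set (bicyclic_III p q r) ws \<and> length ws = n) \<longleftrightarrow>
      (\<exists>ws. resolving_set (bicyclic_III r q p) ws \<and> length ws = n)" for n
    using ex[of p r q] ex[of r p q] assms by metis
  then show ?thesis by (simp add: metric_dimension_def)
qed

lemma metric_dimension_bicyclic_III_diag:
  assumes "2 \<le> q" "1 \<le> r"
  shows "metric_dimension (bicyclic_III q q r) = (if int q - int r \<noteq> 2 then 2 else 3)"
proof -
  interpret bicyclic q q r using assms by unfold_locales auto
  consider "q - 1 \<le> r" | "r + 3 \<le> q" | "q = r + 2" by linarith
  then show ?thesis
  proof cases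
    case 1
    then show ?thesis using metric_dimension_long assms by auto
  next
    case 2
    then show ?thesis using metric_dimension_short by auto
  next
    case 3
    then interpret bicyclic_exceptional q q r by unfold_locales auto
    show ?thesis using metric_dimension_exceptional 3 by simp
  qed
qed

theorem theorem5:
  fixes p q r :: nat
  assumes "1 \<le> p" and "1 \<le> r" and "2 \<le> q"
  shows "(p = q \<longrightarrow>
            metric_dimension (bicyclic_III p q r) = (if int q - int r \<noteq> 2 then 2 else 3)) \<and>
         (r = q \<longrightarrow>
            metric_dimension (bicyclic_III p q r) = (if int q - int p \<noteq> 2 then 2 else 3))"
  using assms metric_dimension_bicyclic_III_diag[of q r] metric_dimension_bicyclic_III_diag[of q p]
    metric_dimension_bicyclic_III_commute[of p r q]
  by auto

end
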